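(* Let $S$ be a finite set. The set of dual surjunctive groups is closed in the space $X_S$ of $S$-marked groups; that is, the set of normal subgroups $N\lhd F_S$ such that $F_S/N$ is dual surjunctive is a closed subset of $X_S$.
   Context: $F_S$ is the free group on $S$. $X_S$ is the set of all normal subgroups of $F_S$, viewed as a (closed) subspace of $2^{F_S}$ with the product topology; $N\in X_S$ is identified with the marked group $F_S/N$. For a group $G$ and a finite set $A$, $A^G$ carries the product topology ($A$ discrete) and the action $(g\cdot f)(x)=f(g^{-1}x)$. A cellular automaton $T\colon A^G\to A^G$ is a continuous $G$-equivariant map. For $c,d\in A^G$ write $c\sim d$ if $\{g\in G: c(g)\neq d(g)\}$ is finite. $T$ is post-surjective if whenever $c,e\in A^G$ and $T(c)\sim e$, there is $c'\sim c$ with $T(c')=e$. $T$ is pre-injective if $c\sim d$ and $T(c)=T(d)$ imply $c=d$. A group $G$ is dual surjunctive if for every finite set $A$, every post-surjective cellular automaton $T\colon A^G\to A^G$ is pre-injective. *)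

theory Defs
  imports "HOL-Analysis.Analysis" "HOL-Algebra.Coset"
begin

section \<open>The free group on a set\<close>

text \<open>A letter \<open>(s, True)\<close> stands for the generator \<open>s\<close>, and \<open>(s, False)\<close> for its inverse.
  The elements of the free group are the reduced words.\<close>

definition flip :: "'s \<times> bool \<Rightarrow> 's \<times> bool" where
  "flip x = (fst x, \<not> snd x)"

definition reduced :: "('s \<times> bool) list \<Rightarrow> bool" where
  "reduced w \<longleftrightarrow> successively (\<lambda>x y. y \<noteq> flip x) w"

fun reduced_Cons :: "'s \<times> bool \<Rightarrow> ('s \<times> bool) list \<Rightarrow> ('s \<times> bool) list" where
  "reduced_Cons x [] = [x]"
| "reduced_Cons x (y # w) = (if y = flip x then w else x # y # w)"

text \<open>For reduced \<open>u\<close> and \<open>v\<close>, the product below is the reduced form of \<open>u @ v\<close>.\<close>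

definition free_group :: "'s set \<Rightarrow> ('s \<times> bool) list monoid" where
  "free_group S = \<lparr>carrier = {w. fst ` set w \<subseteq> S \<and> reduced w},
     mult = (\<lambda>u v. foldr reduced_Cons u v), one = []\<rparr>"

lemma flip_flip [simp]: "flip (flip x) = x"
  by (simp add: flip_def)

lemma fst_flip [simp]: "fst (flip x) = fst x"
  by (simp add: flip_def)

lemma reduced_tl: "reduced (x # w) \<Longrightarrow> reduced w"
  by (cases w) (auto simp: reduced_def)

lemma reduced_reduced_Cons: "reduced w \<Longrightarrow> reduced (reduced_Cons x w)"
  by (cases w) (auto simp: reduced_def intro: reduced_tl[unfolded reduced_def])

lemma reduced_foldr: "reduced w \<Longrightarrow> reduced (foldr reduced_Cons u w)"
  by (induction u) (auto simp: reduced_reduced_Cons)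

lemma reduced_Cons_flip: "reduced w \<Longrightarrow> reduced_Cons x (reduced_Cons (flip x) w) = w"
  by (cases w rule: remdups_adj.cases) (auto simp: reduced_def)

lemma foldr_reduced_Cons:
  "reduced w \<Longrightarrow> foldr reduced_Cons (reduced_Cons x v) w = reduced_Cons x (foldr reduced_Cons v w)"
  by (cases v) (auto simp: reduced_Cons_flip reduced_foldr)

lemma foldr_reduced_Cons_assoc:
  "reduced w \<Longrightarrow>
    foldr reduced_Cons (foldr reduced_Cons u v) w = foldr reduced_Cons u (foldr reduced_Cons v w)"
  by (induction u) (auto simp: foldr_reduced_Cons)

lemma foldr_reduced_Cons_Nil: "reduced u \<Longrightarrow> foldr reduced_Cons u [] = u"
proof (induction u)
  case (Cons x u)
  then show ?case by (cases u) (auto simp: reduced_def)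
qed simp

lemma set_reduced_Cons: "set (reduced_Cons x w) \<subseteq> insert x (set w)"
  by (cases w) auto

lemma set_foldr_reduced_Cons: "set (foldr reduced_Cons u w) \<subseteq> set u \<union> set w"
proof (induction u)
  case (Cons x u)
  then show ?case using set_reduced_Cons[of x "foldr reduced_Cons u w"] by auto
qed simp

lemma reduced_inverse: "reduced w \<Longrightarrow> reduced (rev (map flip w))"
  unfolding reduced_def successively_rev successively_map
  by (erule successively_mono) (metis flip_flip)

lemma foldr_inverse:
  "reduced w \<Longrightarrow> foldr reduced_Cons (rev (map flip u)) (foldr reduced_Cons u w) = w"
proof (induction u arbitrary: w)
  case (Cons x u)
  then show ?case
    using reduced_Cons_flip[of "foldr reduced_Cons u w" "flip x"] by (simp add: reduced_foldr)
qed simp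

theorem group_free_group: "group (free_group S)"
proof (rule groupI)
  fix u v assume "u \<in> carrier (free_group S)" "v \<in> carrier (free_group S)"
  then show "u \<otimes>\<^bsub>free_group S\<^esub> v \<in> carrier (free_group S)"
    using set_foldr_reduced_Cons[of u v] by (fastforce simp: free_group_def reduced_foldr)
next
  fix u assume u: "u \<in> carrier (free_group S)"
  have "fst ` set (rev (map flip u)) = fst ` set u"
    by (simp add: image_image)
  then have "rev (map flip u) \<in> carrier (free_group S)"
    using u by (simp add: free_group_def reduced_inverse)
  moreover have "rev (map flip u) \<otimes>\<^bsub>free_group S\<^esub> u = \<one>\<^bsub>free_group S\<^esub>"
    using u foldr_inverse[of "[]" u]
    by (simp add: free_group_def foldr_reduced_Cons_Nil reduced_def)
  ultimately show "\<exists>v\<in>carrier (free_group S). v \<otimes>\<^bsub>free_group S\<^esub> u = \<one>\<^bsub>free_group S\<^esub>"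
    by blast
qed (auto simp: free_group_def foldr_reduced_Cons_assoc reduced_def)

theorem free_group_universal_property:
  assumes "group H" and f: "f \<in> S \<rightarrow> carrier H"
  shows "\<exists>!h. h \<in> hom (free_group S) H \<and> h \<in> extensional (carrier (free_group S)) \<and>
    (\<forall>s\<in>S. h [(s, True)] = f s)"
proof -
  interpret H: group H by fact
  interpret F: group "free_group S" by (rule group_free_group)
  define v where "v = (\<lambda>x. if snd x then f (fst x) else inv\<^bsub>H\<^esub> (f (fst x)))"
  define ev where "ev = (\<lambda>w. foldr (\<lambda>x y. v x \<otimes>\<^bsub>H\<^esub> y) w \<one>\<^bsub>H\<^esub>)"
  have v_closed: "v x \<in> carrier H" if "fst x \<in> S" for x
    using that f by (auto simp: v_def)
  have v_flip: "v x \<otimes>\<^bsub>H\<^esub> v (flip x) = \<one>\<^bsub>H\<^esub>" if "fst x \<in> S" for x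
  proof -
    have "f (fst x) \<in> carrier H" using that f by auto
    then show ?thesis using H.r_inv H.l_inv by (simp add: v_def flip_def)
  qed
  have ev_closed: "ev w \<in> carrier H" if "fst ` set w \<subseteq> S" for w
    using that by (induction w) (auto simp: ev_def v_closed)
  have ev_Cons: "ev (reduced_Cons x w) = v x \<otimes>\<^bsub>H\<^esub> ev w" if "fst x \<in> S" "fst ` set w \<subseteq> S" for x w
  proof (cases w)
    case (Cons y w')
    have "ev w' \<in> carrier H" using ev_closed that Cons by auto
    then show ?thesis
      using that Cons v_closed[of x] v_closed[of "flip x"] v_flip[of x]
      by (auto simp: ev_def simp flip: H.m_assoc)
  qed (simp add: ev_def)
  have ev_foldr: "ev (foldr reduced_Cons u w) = ev u \<otimes>\<^bsub>H\<^esub> ev w"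
    if "fst ` set u \<subseteq> S" "fst ` set w \<subseteq> S" for u w
    using that
  proof (induction u)
    case Nil
    then show ?case using ev_closed[of w] by (simp add: ev_def)
  next
    case (Cons x u)
    then have "fst ` set (foldr reduced_Cons u w) \<subseteq> S"
      using set_foldr_reduced_Cons[of u w] by fastforce
    then have "ev (foldr reduced_Cons (x # u) w) = v x \<otimes>\<^bsub>H\<^esub> (ev u \<otimes>\<^bsub>H\<^esub> ev w)"
      using Cons by (simp add: ev_Cons)
    also have "\<dots> = ev (x # u) \<otimes>\<^bsub>H\<^esub> ev w"
      using Cons.prems v_closed[of x] ev_closed[of u] ev_closed[of w]
      by (simp add: ev_def H.m_assoc)
    finally show ?case .
  qed
  have gen: "[x] \<in> carrier (free_group S)" if "fst x \<in> S" for x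
    using that by (simp add: free_group_def reduced_def)
  show ?thesis
  proof (rule ex1I[of _ "restrict ev (carrier (free_group S))"], intro conjI ballI)
    show "restrict ev (carrier (free_group S)) \<in> hom (free_group S) H"
    proof (rule homI)
      fix x y assume xy: "x \<in> carrier (free_group S)" "y \<in> carrier (free_group S)"
      then have "ev (x \<otimes>\<^bsub>free_group S\<^esub> y) = ev x \<otimes>\<^bsub>H\<^esub> ev y"
        using ev_foldr[of x y] by (auto simp: free_group_def)
      then show "restrict ev (carrier (free_group S)) (x \<otimes>\<^bsub>free_group S\<^esub> y) =
          restrict ev (carrier (free_group S)) x \<otimes>\<^bsub>H\<^esub> restrict ev (carrier (free_group S)) y"
        using xy F.m_closed[OF xy] by simp
    qed (auto simp: free_group_def intro: ev_closed)
    show "restrict ev (carrier (free_group S)) \<in> extensional (carrier (free_group S))"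
      by (rule restrict_extensional)
    show "restrict ev (carrier (free_group S)) [(s, True)] = f s" if "s \<in> S" for s
      using gen[of "(s, True)"] that H.r_one[OF funcset_mem[OF f that]]
      by (simp add: ev_def v_def)
  next
    fix h assume h: "h \<in> hom (free_group S) H \<and> h \<in> extensional (carrier (free_group S)) \<and>
      (\<forall>s\<in>S. h [(s, True)] = f s)"
    interpret h: group_hom "free_group S" H h
      using h by unfold_locales auto
    have inv_gen: "inv\<^bsub>free_group S\<^esub> [(s, True)] = [(s, False)]" if "s \<in> S" for s
      using gen[of "(s, True)"] gen[of "(s, False)"] that
      by (intro F.inv_equality) (auto simp: free_group_def flip_def)
    have h_gen: "h [x] = v x" if "fst x \<in> S" for x
    proof (cases "snd x")
      case True
      then have "x = (fst x, True)" by (metis prod.collapse)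
      then show ?thesis using h that unfolding v_def by (metis snd_conv)
    next
      case False
      then have "x = (fst x, False)" by (metis prod.collapse)
      then have "h [x] = h (inv\<^bsub>free_group S\<^esub> [(fst x, True)])" using inv_gen that by metis
      also have "\<dots> = inv\<^bsub>H\<^esub> (f (fst x))"
        using h that gen[of "(fst x, True)"] by simp
      finally show ?thesis using False by (simp add: v_def)
    qed
    have h_ev: "h w = ev w" if "w \<in> carrier (free_group S)" for w
      using that
    proof (induction w)
      case Nil
      then show ?case using h.hom_one by (simp add: ev_def free_group_def)
    next
      case (Cons x w)
      have w: "w \<in> carrier (free_group S)" and x: "fst x \<in> S"
        using Cons.prems by (auto simp: free_group_def intro: reduced_tl)
      have "x # w = [x] \<otimes>\<^bsub>free_group S\<^esub> w"
        using Cons.prems by (cases w) (auto simp: free_group_def reduced_def)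
      then have "h (x # w) = h [x] \<otimes>\<^bsub>H\<^esub> h w"
        using h.hom_mult[OF gen[OF x] w] by simp
      then show ?case using Cons.IH[OF w] h_gen[OF x] by (simp add: ev_def)
    qed
    show "h = restrict ev (carrier (free_group S))"
      using h h_ev by (auto simp: extensional_def restrict_def)
  qed
qed


section \<open>The space of marked groups\<close>

text \<open>The product topology on \<open>2\<^sup>X\<close>, carried over to \<open>Pow X\<close> by identifying a subset of \<open>X\<close>
  with its indicator function.\<close>

definition powerset_topology :: "'a set \<Rightarrow> 'a set topology" where
  "powerset_topology X =
     pullback_topology (Pow X) (\<lambda>N. \<lambda>x\<in>X. x \<in> N)
       (product_topology (\<lambda>_. discrete_topology (UNIV :: bool set)) X)"

definition marked_groups :: "'s set \<Rightarrow> ('s \<times> bool) list set topology" where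
  "marked_groups S =
     subtopology (powerset_topology (carrier (free_group S))) {N. N \<lhd> free_group S}"

lemma topspace_marked_groups: "topspace (marked_groups S) = {N. N \<lhd> free_group S}"
  by (auto simp: marked_groups_def powerset_topology_def topspace_pullback_topology
      dest: normal_imp_subgroup subgroup.subset)


section \<open>Cellular automata and dual surjunctivity\<close>

text \<open>The configuration space \<open>A\<^sup>G\<close>; its points are the functions in
  \<open>carrier G \<rightarrow>\<^sub>E A\<close>, i.e. those that are \<open>undefined\<close> outside \<open>carrier G\<close>.\<close>

definition full_shift :: "('g, 'm) monoid_scheme \<Rightarrow> 'a set \<Rightarrow> ('g \<Rightarrow> 'a) topology" where
  "full_shift G A = product_topology (\<lambda>_. discrete_topology A) (carrier G)"

definition shift :: "('g, 'm) monoid_scheme \<Rightarrow> 'g \<Rightarrow> ('g \<Rightarrow> 'a) \<Rightarrow> ('g \<Rightarrow> 'a)" where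
  "shift G g f = (\<lambda>x\<in>carrier G. f (inv\<^bsub>G\<^esub> g \<otimes>\<^bsub>G\<^esub> x))"

definition cellular_automaton ::
  "('g, 'm) monoid_scheme \<Rightarrow> 'a set \<Rightarrow> (('g \<Rightarrow> 'a) \<Rightarrow> ('g \<Rightarrow> 'a)) \<Rightarrow> bool" where
  "cellular_automaton G A T \<longleftrightarrow>
     continuous_map (full_shift G A) (full_shift G A) T \<and>
     (\<forall>g\<in>carrier G. \<forall>f\<in>topspace (full_shift G A). T (shift G g f) = shift G g (T f))"

definition asymptotic :: "('g, 'm) monoid_scheme \<Rightarrow> ('g \<Rightarrow> 'a) \<Rightarrow> ('g \<Rightarrow> 'a) \<Rightarrow> bool" where
  "asymptotic G c d \<longleftrightarrow> finite {g \<in> carrier G. c g \<noteq> d g}"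

definition post_surjective ::
  "('g, 'm) monoid_scheme \<Rightarrow> 'a set \<Rightarrow> (('g \<Rightarrow> 'a) \<Rightarrow> ('g \<Rightarrow> 'a)) \<Rightarrow> bool" where
  "post_surjective G A T \<longleftrightarrow>
     (\<forall>c\<in>topspace (full_shift G A). \<forall>e\<in>topspace (full_shift G A). asymptotic G (T c) e \<longrightarrow>
       (\<exists>c'\<in>topspace (full_shift G A). asymptotic G c' c \<and> T c' = e))"

definition pre_injective ::
  "('g, 'm) monoid_scheme \<Rightarrow> 'a set \<Rightarrow> (('g \<Rightarrow> 'a) \<Rightarrow> ('g \<Rightarrow> 'a)) \<Rightarrow> bool" where
  "pre_injective G A T \<longleftrightarrow>
     (\<forall>c\<in>topspace (full_shift G A). \<forall>d\<in>topspace (full_shift G A).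
       asymptotic G c d \<and> T c = T d \<longrightarrow> c = d)"

text \<open>A definition cannot quantify over the type of the alphabet. Every finite set is in bijection
  with a finite set of natural numbers, so alphabets \<open>A :: nat set\<close> suffice; see
  \<open>dual_surjunctive_alphabet\<close> below.\<close>

definition dual_surjunctive :: "('g, 'm) monoid_scheme \<Rightarrow> bool" where
  "dual_surjunctive G \<longleftrightarrow>
     (\<forall>(A :: nat set) T. finite A \<longrightarrow> cellular_automaton G A T \<longrightarrow> post_surjective G A T \<longrightarrow>
       pre_injective G A T)"

lemma topspace_full_shift: "topspace (full_shift G A) = (carrier G \<rightarrow>\<^sub>E A)"
  by (simp add: full_shift_def)

lemma continuous_map_relabel:
  assumes "\<phi> ` A \<subseteq> B"
  shows "continuous_map (full_shift G A) (full_shift G B) (\<lambda>c. \<lambda>x\<in>carrier G. \<phi> (c x))"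
  unfolding full_shift_def continuous_map_componentwise
proof (intro conjI ballI)
  fix k assume k: "k \<in> carrier G"
  have "continuous_map (product_topology (\<lambda>_. discrete_topology A) (carrier G))
      (discrete_topology B) (\<phi> \<circ> (\<lambda>c. c k))"
    using assms k
    by (intro continuous_map_compose[of _ "discrete_topology A"])
      (auto intro: continuous_map_product_projection)
  then show "continuous_map (product_topology (\<lambda>_. discrete_topology A) (carrier G))
      (discrete_topology B) (\<lambda>c. (\<lambda>x\<in>carrier G. \<phi> (c x)) k)"
    using k by (simp add: o_def)
qed auto

lemma dual_surjunctive_alphabet:
  fixes G :: "('g, 'm) monoid_scheme" and A :: "'a set"
  assumes "group G" and ds: "dual_surjunctive G" and fin: "finite A"
    and ca: "cellular_automaton G A T" and ps: "post_surjective G A T"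
  shows "pre_injective G A T"
proof -
  interpret group G by fact
  obtain \<phi> :: "'a \<Rightarrow> nat" and n where "\<phi> ` A = {..<n}" and inj: "inj_on \<phi> A"
    using fin finite_imp_inj_to_nat_seg by (metis lessThan_def)
  define B where "B = \<phi> ` A"
  define \<psi> where "\<psi> = inv_into A \<phi>"
  define L where "L = (\<lambda>c. \<lambda>x\<in>carrier G. \<phi> (c x))"
  define M where "M = (\<lambda>c. \<lambda>x\<in>carrier G. \<psi> (c x))"
  have \<psi>\<phi>: "\<psi> (\<phi> a) = a" if "a \<in> A" for a using that inj by (simp add: \<psi>_def)
  have \<phi>\<psi>: "\<phi> (\<psi> b) = b" "\<psi> b \<in> A" if "b \<in> B" for b
    using that by (auto simp: \<psi>_def B_def f_inv_into_f inv_into_into)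
  have \<psi>B: "\<psi> ` B \<subseteq> A" using \<phi>\<psi> by auto
  let ?X = "carrier G \<rightarrow>\<^sub>E A" and ?Y = "carrier G \<rightarrow>\<^sub>E B"
  have Lc: "L c \<in> ?Y" if "c \<in> ?X" for c using that by (auto simp: L_def B_def)
  have Mc: "M c \<in> ?X" if "c \<in> ?Y" for c using that \<phi>\<psi>(2) by (auto simp: M_def)
  have M_L: "M (L c) = c" if "c \<in> ?X" for c
  proof
    fix x show "M (L c) x = c x"
      using \<psi>\<phi>[OF PiE_mem[OF that]] PiE_arb[OF that]
      by (cases "x \<in> carrier G") (simp_all add: M_def L_def)
  qed
  have L_M: "L (M c) = c" if "c \<in> ?Y" for c
  proof
    fix x show "L (M c) x = c x"
      using \<phi>\<psi>(1)[OF PiE_mem[OF that]] PiE_arb[OF that]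
      by (cases "x \<in> carrier G") (simp_all add: M_def L_def)
  qed
  have asL: "asymptotic G (L c) (L d)" if "asymptotic G c d" for c d
    using that unfolding asymptotic_def by (rule rev_finite_subset) (auto simp: L_def)
  have asM: "asymptotic G (M c) (M d)" if "asymptotic G c d" for c d
    using that unfolding asymptotic_def by (rule rev_finite_subset) (auto simp: M_def)
  have shL: "L (shift G g c) = shift G g (L c)" if "g \<in> carrier G" for g and c :: "'g \<Rightarrow> 'a"
    using that by (auto simp: L_def shift_def)
  have shM: "M (shift G g c) = shift G g (M c)" if "g \<in> carrier G" for g and c :: "'g \<Rightarrow> nat"
    using that by (auto simp: M_def shift_def)
  have Tc: "T c \<in> ?X" if "c \<in> ?X" for c
    using ca that unfolding cellular_automaton_def continuous_map_def topspace_full_shift by blast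
  define U where "U = L \<circ> T \<circ> M"
  have "cellular_automaton G B U"
    unfolding cellular_automaton_def
  proof (intro conjI ballI)
    show "continuous_map (full_shift G B) (full_shift G B) U"
      unfolding U_def
    proof (intro continuous_map_compose)
      show "continuous_map (full_shift G B) (full_shift G A) M"
        unfolding M_def by (rule continuous_map_relabel[OF \<psi>B])
      show "continuous_map (full_shift G A) (full_shift G A) T"
        using ca by (simp add: cellular_automaton_def)
      show "continuous_map (full_shift G A) (full_shift G B) L"
        unfolding L_def by (rule continuous_map_relabel) (simp add: B_def)
    qed
    fix g f assume g: "g \<in> carrier G" and "f \<in> topspace (full_shift G B)"
    then have "M f \<in> topspace (full_shift G A)" using Mc by (simp add: topspace_full_shift)
    then show "U (shift G g f) = shift G g (U f)"
      using ca g by (simp add: U_def shL shM cellular_automaton_def)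
  qed
  moreover have "post_surjective G B U"
    unfolding post_surjective_def topspace_full_shift
  proof (intro ballI impI)
    fix c e assume c: "c \<in> ?Y" and e: "e \<in> ?Y" and as: "asymptotic G (U c) e"
    have "asymptotic G (T (M c)) (M e)"
      using asM[OF as] M_L[OF Tc[OF Mc[OF c]]] by (simp add: U_def)
    then obtain c' where c': "c' \<in> ?X" "asymptotic G c' (M c)" "T c' = M e"
      using ps Mc[OF c] Mc[OF e] unfolding post_surjective_def topspace_full_shift by blast
    have "asymptotic G (L c') c" using asL[OF c'(2)] L_M[OF c] by simp
    moreover have "U (L c') = e" using c' M_L L_M[OF e] by (simp add: U_def)
    ultimately show "\<exists>c'\<in>?Y. asymptotic G c' c \<and> U c' = e" using Lc[OF c'(1)] by blast
  qed
  moreover have "finite B" using fin by (simp add: B_def)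
  ultimately have pre: "pre_injective G B U"
    using ds unfolding dual_surjunctive_def by blast
  show ?thesis
    unfolding pre_injective_def topspace_full_shift
  proof (intro ballI impI)
    fix c d assume c: "c \<in> ?X" and d: "d \<in> ?X" and as: "asymptotic G c d \<and> T c = T d"
    then have "U (L c) = U (L d)" using M_L by (simp add: U_def)
    then have "L c = L d"
      using pre asL as Lc[OF c] Lc[OF d] unfolding pre_injective_def topspace_full_shift by blast
    then show "c = d" using M_L c d by metis
  qed
qed

end

theory Submission
  imports Defs
begin

text \<open>
  Failure of dual surjunctivity is visible on a finite piece of the multiplication table, and nearby
  marked groups share finite pieces of their tables.

  A cellular automaton over a finite alphabet is given by a local rule with a finite memory set
  (\<open>curtis_hedlund_lyndon\<close>). The rule makes sense on every group that contains a copy of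
  the memory set, so an automaton on \<open>G\<close> can be carried along a map \<open>\<beta>\<close> that embeds a large
  finite \<open>B \<subseteq> G\<close> into another group \<open>H\<close> and respects those products that stay
  inside \<open>B\<close>. Both halves of a counterexample survive the transport.

  Failure of pre-injectivity is witnessed by two configurations that differ on a finite set;
  equality of their images has to be checked only at the finitely many cells that see the difference.

  Post-surjectivity looks like an infinite condition. By equivariance and induction on the number of
  cells to be corrected, it suffices to be able to correct the image of any configuration
  at the single cell \<open>1\<close> (\<open>post_surjective_if_correctable_at_one\<close>). For each
  configuration \<open>c\<close> on \<open>G\<close>, the required modifications of \<open>c\<close> live on a finite
  set, and the very same modifications work for every configuration that agrees with \<open>c\<close> on
  a larger finite set. By compactness of the full shift, finitely many such recipes serve all
  configurations (\<open>finite_cylinder_cover\<close>); so all recipes together involve only finitely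
  many group elements and can be applied in \<open>H\<close> as soon as \<open>B\<close> contains these.

  Hence for a group \<open>G\<close> that is not dual surjunctive there is a finite \<open>B\<close> that cannot
  be locally embedded into a dual surjunctive group (\<open>not_dual_surjunctive_local\<close>).
  If \<open>G = F/N\<close>, such an embedding into \<open>F/N'\<close> exists whenever \<open>N'\<close> and \<open>N\<close>
  contain the same elements of a certain finite subset of \<open>F\<close>
  (\<open>quotient_local_embedding\<close>), which is an open condition on \<open>N'\<close>. So the marked
  groups that are not dual surjunctive form an open set.
\<close>

section \<open>Cylinders and compactness\<close>

definition cylinder :: "('g, 'm) monoid_scheme \<Rightarrow> 'a set \<Rightarrow> 'g set \<Rightarrow> ('g \<Rightarrow> 'a) \<Rightarrow> ('g \<Rightarrow> 'a) set" where
  "cylinder G A K c = {d \<in> carrier G \<rightarrow>\<^sub>E A. \<forall>k\<in>K. d k = c k}"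

lemma openin_cylinder:
  assumes "finite K" "K \<subseteq> carrier G"
  shows "openin (full_shift G A) (cylinder G A K c)"
proof -
  let ?U = "\<lambda>i. if i \<in> K then A \<inter> {c i} else A"
  have "d \<in> cylinder G A K c \<longleftrightarrow> d \<in> PiE (carrier G) ?U" for d
    using assms(2) unfolding cylinder_def PiE_iff by (auto split: if_split_asm)
  then have "cylinder G A K c = PiE (carrier G) ?U" by blast
  moreover have "finite {i \<in> carrier G. ?U i \<noteq> A}"
    by (rule finite_subset[OF _ assms(1)]) auto
  then have "openin (full_shift G A) (PiE (carrier G) ?U)"
    unfolding full_shift_def openin_PiE_gen by simp
  ultimately show ?thesis by simp
qed

lemma compact_space_full_shift: "finite A \<Longrightarrow> compact_space (full_shift G A)"
  unfolding full_shift_def by (simp add: compact_space_product_topology compact_space_discrete_topology)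

text \<open>Every use of compactness below has this form: a finite window \<open>K c\<close> is assigned to
  each configuration \<open>c\<close>, and the cylinders around the \<open>c\<close> cover the compact full shift.\<close>

lemma finite_cylinder_cover:
  fixes G :: "('g, 'm) monoid_scheme"
  assumes "finite A" and K: "\<And>c. c \<in> carrier G \<rightarrow>\<^sub>E A \<Longrightarrow> finite (K c) \<and> K c \<subseteq> carrier G"
  obtains F where "finite F" "F \<subseteq> carrier G \<rightarrow>\<^sub>E A"
    "\<forall>d\<in>carrier G \<rightarrow>\<^sub>E A. \<exists>c\<in>F. \<forall>k\<in>K c. d k = c k"
proof -
  let ?X = "carrier G \<rightarrow>\<^sub>E A"
  let ?C = "\<lambda>c. cylinder G A (K c) c"
  have "c \<in> ?C c" if "c \<in> ?X" for c using that by (simp add: cylinder_def)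
  then have "?X \<subseteq> \<Union>(?C ` ?X)" by blast
  moreover have "openin (full_shift G A) U" if U: "U \<in> ?C ` ?X" for U
  proof -
    obtain c where "c \<in> ?X" "U = ?C c" using U by blast
    then show ?thesis using K[of c] openin_cylinder[of "K c" G A c] by simp
  qed
  moreover have "compactin (full_shift G A) ?X"
    using compact_space_full_shift[OF assms(1)] by (metis compact_space_def topspace_full_shift)
  ultimately obtain \<F> where \<F>: "finite \<F>" "\<F> \<subseteq> ?C ` ?X" and cov: "?X \<subseteq> \<Union>\<F>"
    using compactinD[of "full_shift G A" ?X "?C ` ?X"] by (metis (no_types, lifting))
  obtain F where F: "F \<subseteq> ?X" "finite F" "\<F> = ?C ` F"
    using finite_subset_image[OF \<F>] by blast
  have "\<forall>d\<in>?X. \<exists>c\<in>F. \<forall>k\<in>K c. d k = c k"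
  proof
    fix d assume "d \<in> ?X"
    then obtain c where "c \<in> F" "d \<in> ?C c" using cov F(3) by blast
    then show "\<exists>c\<in>F. \<forall>k\<in>K c. d k = c k" unfolding cylinder_def by blast
  qed
  with F(2,1) show thesis by (rule that)
qed

text \<open>A map to a discrete space is locally constant. The finite windows on which it is constant
  vary with the configuration; the union of the finitely many windows of a subcover works everywhere.\<close>

lemma continuous_finite_support:
  assumes "finite A" and \<nu>: "continuous_map (full_shift G A) (discrete_topology B) \<nu>"
  obtains M where "finite M" "M \<subseteq> carrier G"
    "\<forall>c\<in>carrier G \<rightarrow>\<^sub>E A. \<forall>d\<in>carrier G \<rightarrow>\<^sub>E A. (\<forall>m\<in>M. c m = d m) \<longrightarrow> \<nu> c = \<nu> d"
proof -
  let ?X = "carrier G \<rightarrow>\<^sub>E A"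
  have "\<exists>K. finite K \<and> K \<subseteq> carrier G \<and> (\<forall>d\<in>cylinder G A K c. \<nu> d = \<nu> c)" if c: "c \<in> ?X" for c
  proof -
    have "openin (full_shift G A) {d \<in> topspace (full_shift G A). \<nu> d \<in> {\<nu> c} \<inter> B}"
      by (rule openin_continuous_map_preimage[OF \<nu>]) auto
    moreover have "\<nu> c \<in> B"
      using \<nu> c by (auto simp: continuous_map_def topspace_full_shift)
    ultimately have "\<exists>X. c \<in> PiE (carrier G) X \<and> (\<forall>i. openin (discrete_topology A) (X i)) \<and>
        finite {i. X i \<noteq> topspace (discrete_topology A)} \<and>
        PiE (carrier G) X \<subseteq> {d \<in> topspace (full_shift G A). \<nu> d \<in> {\<nu> c} \<inter> B}"
      unfolding full_shift_def using c
      by (intro product_topology_open_contains_basis) auto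
    then obtain X where X: "c \<in> PiE (carrier G) X"
        "finite {i. X i \<noteq> topspace (discrete_topology A)}"
        "PiE (carrier G) X \<subseteq> {d \<in> topspace (full_shift G A). \<nu> d \<in> {\<nu> c} \<inter> B}"
      by blast
    then have fin: "finite {i. X i \<noteq> A}" and sub: "PiE (carrier G) X \<subseteq> {d. \<nu> d = \<nu> c}"
      by auto
    let ?K = "{i. X i \<noteq> A} \<inter> carrier G"
    have "d \<in> PiE (carrier G) X" if "d \<in> cylinder G A ?K c" for d
    proof (rule PiE_I)
      fix x assume "x \<in> carrier G"
      then show "d x \<in> X x"
        using that X(1) by (cases "X x = A") (auto simp: cylinder_def PiE_iff)
    qed (use that in \<open>auto simp: cylinder_def PiE_iff extensional_def\<close>)
    then have "\<forall>d\<in>cylinder G A ?K c. \<nu> d = \<nu> c" using sub by blast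
    then show ?thesis using fin by (intro exI[of _ ?K]) blast
  qed
  then obtain K where K: "\<And>c. c \<in> ?X \<Longrightarrow> finite (K c) \<and> K c \<subseteq> carrier G \<and>
      (\<forall>d\<in>cylinder G A (K c) c. \<nu> d = \<nu> c)"
    by metis
  have finK: "finite (K c) \<and> K c \<subseteq> carrier G" if "c \<in> ?X" for c using K[OF that] by simp
  obtain F where F: "finite F" "F \<subseteq> ?X"
    "\<forall>d\<in>?X. \<exists>c\<in>F. \<forall>k\<in>K c. d k = c k"
    by (rule finite_cylinder_cover[OF assms(1) finK])
  show thesis
  proof (rule that[of "\<Union>(K ` F)"])
    show "finite (\<Union>(K ` F))" "\<Union>(K ` F) \<subseteq> carrier G" using F(1) finK[OF subsetD[OF F(2)]] by auto
    show "\<forall>c\<in>?X. \<forall>d\<in>?X. (\<forall>m\<in>\<Union>(K ` F). c m = d m) \<longrightarrow> \<nu> c = \<nu> d"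
    proof (intro ballI impI)
      fix c d assume c: "c \<in> ?X" and d: "d \<in> ?X" and eq: "\<forall>m\<in>\<Union>(K ` F). c m = d m"
      obtain b where b: "b \<in> F" "\<forall>k\<in>K b. c k = b k" using F(3) c by blast
      then have "c \<in> cylinder G A (K b) b" "d \<in> cylinder G A (K b) b"
        using c d eq by (simp_all add: cylinder_def)
      moreover have "b \<in> ?X" using b(1) F(2) by (rule subsetD[rotated])
      ultimately show "\<nu> c = \<nu> d" using K[of b] by simp
    qed
  qed
qed

section \<open>Cellular automata given by local rules\<close>

text \<open>The memory set is parametrised by a map \<open>v\<close> from an index set \<open>M\<close> into the
  group. In this way the same local rule \<open>\<mu>\<close>, a function of patterns on \<open>M\<close>, can be used
  on different groups by changing \<open>v\<close> alone.\<close>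

definition block_map ::
  "('g, 'm) monoid_scheme \<Rightarrow> 'i set \<Rightarrow> ('i \<Rightarrow> 'g) \<Rightarrow> (('i \<Rightarrow> 'a) \<Rightarrow> 'a) \<Rightarrow> ('g \<Rightarrow> 'a) \<Rightarrow> ('g \<Rightarrow> 'a)" where
  "block_map G M v \<mu> c = (\<lambda>g\<in>carrier G. \<mu> (\<lambda>m\<in>M. c (g \<otimes>\<^bsub>G\<^esub> v m)))"

lemma (in group) block_map_closed:
  assumes "v \<in> M \<rightarrow> carrier G" "\<mu> \<in> (M \<rightarrow>\<^sub>E A) \<rightarrow> A" "c \<in> carrier G \<rightarrow>\<^sub>E A"
  shows "block_map G M v \<mu> c \<in> carrier G \<rightarrow>\<^sub>E A"
  unfolding block_map_def
proof (rule restrict_PiE_iff[THEN iffD2], intro ballI funcset_mem[OF assms(2)])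
  fix g assume "g \<in> carrier G"
  then show "(\<lambda>m\<in>M. c (g \<otimes> v m)) \<in> M \<rightarrow>\<^sub>E A"
    using assms(1,3) by (intro restrict_PiE_iff[THEN iffD2] ballI) (auto intro!: PiE_mem[OF assms(3)])
qed

lemma (in group) cellular_automaton_block_map:
  assumes "finite M" and v: "v \<in> M \<rightarrow> carrier G" and \<mu>: "\<mu> \<in> (M \<rightarrow>\<^sub>E A) \<rightarrow> A"
  shows "cellular_automaton G A (block_map G M v \<mu>)"
  unfolding cellular_automaton_def
proof (intro conjI ballI)
  let ?T = "block_map G M v \<mu>"
  show "continuous_map (full_shift G A) (full_shift G A) ?T"
    unfolding full_shift_def[of G A] continuous_map_componentwise
  proof (intro conjI ballI)
    fix g assume g: "g \<in> carrier G"
    show "continuous_map (product_topology (\<lambda>_. discrete_topology A) (carrier G))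
       (discrete_topology A) (\<lambda>c. ?T c g)"
      unfolding full_shift_def[symmetric] continuous_map_def topspace_full_shift
    proof (intro conjI allI impI)
      show "(\<lambda>c. ?T c g) \<in> (carrier G \<rightarrow>\<^sub>E A) \<rightarrow> topspace (discrete_topology A)"
        using block_map_closed[OF v \<mu>] g by auto
      fix U
      let ?V = "{c \<in> carrier G \<rightarrow>\<^sub>E A. ?T c g \<in> U}" and ?K = "(\<lambda>m. g \<otimes> v m) ` M"
      show "openin (full_shift G A) ?V"
      proof (subst openin_subopen, intro ballI exI conjI)
        fix c assume c: "c \<in> ?V"
        show "openin (full_shift G A) (cylinder G A ?K c)"
          using assms(1) v g by (intro openin_cylinder) auto
        show "c \<in> cylinder G A ?K c" using c by (simp add: cylinder_def)
        \<comment> \<open>the image at \<open>g\<close> reads only the cells in \<open>?K\<close>\<close>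
        show "cylinder G A ?K c \<subseteq> ?V"
        proof
          fix d assume d: "d \<in> cylinder G A ?K c"
          then have "(\<lambda>m\<in>M. d (g \<otimes> v m)) = (\<lambda>m\<in>M. c (g \<otimes> v m))"
            by (intro restrict_ext) (simp add: cylinder_def)
          then show "d \<in> ?V" using c d g by (simp add: block_map_def cylinder_def)
        qed
      qed
    qed
  qed (use block_map_closed[OF v \<mu>] in \<open>auto simp: PiE_iff\<close>)
  fix g f assume g: "g \<in> carrier G"
  show "?T (shift G g f) = shift G g (?T f)"
  proof
    fix x
    show "?T (shift G g f) x = shift G g (?T f) x"
    proof (cases "x \<in> carrier G")
      case True
      have "(\<lambda>m\<in>M. shift G g f (x \<otimes> v m)) = (\<lambda>m\<in>M. f (inv g \<otimes> x \<otimes> v m))"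
      proof (rule restrict_ext)
        fix m assume "m \<in> M"
        then have "v m \<in> carrier G" using v by (rule funcset_mem[rotated])
        then show "shift G g f (x \<otimes> v m) = f (inv g \<otimes> x \<otimes> v m)"
          using True g by (simp add: shift_def m_assoc)
      qed
      then show ?thesis using True g by (simp add: block_map_def shift_def)
    qed (simp add: block_map_def shift_def)
  qed
qed

text \<open>The image at the identity is a continuous function into a finite discrete set, so it depends on
  finitely many cells; by equivariance it determines the image everywhere.\<close>

lemma (in group) curtis_hedlund_lyndon:
  assumes "finite A" "A \<noteq> {}" and ca: "cellular_automaton G A T"
  obtains M \<mu> where "finite M" "M \<subseteq> carrier G" "\<mu> \<in> (M \<rightarrow>\<^sub>E A) \<rightarrow> A"
    "\<forall>c\<in>carrier G \<rightarrow>\<^sub>E A. T c = block_map G M id \<mu> c"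
proof -
  let ?X = "carrier G \<rightarrow>\<^sub>E A"
  obtain a where a: "a \<in> A" using assms(2) by blast
  have T: "continuous_map (full_shift G A) (full_shift G A) T"
    and eqv: "\<And>g c. g \<in> carrier G \<Longrightarrow> c \<in> ?X \<Longrightarrow> T (shift G g c) = shift G g (T c)"
    using ca by (auto simp: cellular_automaton_def topspace_full_shift)
  have Tc: "T c \<in> ?X" if "c \<in> ?X" for c
    using T that by (auto simp: continuous_map_def topspace_full_shift)
  have "continuous_map (full_shift G A) (discrete_topology A) (\<lambda>c. T c \<one>)"
    using T unfolding full_shift_def[of G A] continuous_map_componentwise by auto
  from continuous_finite_support[OF assms(1) this]
  obtain M where M: "finite M" "M \<subseteq> carrier G"
    "\<forall>c\<in>?X. \<forall>d\<in>?X. (\<forall>m\<in>M. c m = d m) \<longrightarrow> T c \<one> = T d \<one>"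
    by blast
  \<comment> \<open>any extension of a pattern on \<open>M\<close> to a configuration will do, here by the constant \<open>a\<close>\<close>
  define ext where "ext = (\<lambda>p. \<lambda>x\<in>carrier G. if x \<in> M then p x else a)"
  define \<mu> where "\<mu> = (\<lambda>p. T (ext p) \<one>)"
  have ext: "ext p \<in> ?X" if "p \<in> M \<rightarrow>\<^sub>E A" for p
    using that a by (auto simp: ext_def PiE_iff)
  show thesis
  proof (rule that[OF M(1,2)])
    show "\<mu> \<in> (M \<rightarrow>\<^sub>E A) \<rightarrow> A"
      using PiE_mem[OF Tc[OF ext]] by (auto simp: \<mu>_def)
    show "\<forall>c\<in>?X. T c = block_map G M id \<mu> c"
    proof (intro ballI)
      fix c assume c: "c \<in> ?X"
      show "T c = block_map G M id \<mu> c"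
      proof (rule PiE_ext[OF Tc[OF c]])
        show "block_map G M id \<mu> c \<in> ?X"
          using M(2) c \<open>\<mu> \<in> (M \<rightarrow>\<^sub>E A) \<rightarrow> A\<close> by (intro block_map_closed) auto
        fix g assume g: "g \<in> carrier G"
        have sh: "shift G (inv g) c \<in> ?X"
          using g c by (auto simp: shift_def PiE_iff)
        have p: "(\<lambda>m\<in>M. c (g \<otimes> m)) \<in> M \<rightarrow>\<^sub>E A"
          using M(2) g c by (auto simp: PiE_iff)
        have "T c g = T (shift G (inv g) c) \<one>"
          using g c eqv[of "inv g" c] by (simp add: shift_def)
        also have "\<dots> = T (ext (\<lambda>m\<in>M. c (g \<otimes> m))) \<one>"
          using M(2) g by (intro M(3)[rule_format, OF sh ext[OF p]]) (auto simp: shift_def ext_def)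
        finally show "T c g = block_map G M id \<mu> c g"
          using g by (simp add: block_map_def \<mu>_def)
      qed
    qed
  qed
qed

section \<open>Post-surjectivity from corrections at one cell\<close>

lemma asymptotic_refl: "asymptotic G c c"
  by (simp add: asymptotic_def)

lemma asymptotic_trans: "asymptotic G c d \<Longrightarrow> asymptotic G d e \<Longrightarrow> asymptotic G c e"
  unfolding asymptotic_def
  by (rule finite_subset[of _ "{g \<in> carrier G. c g \<noteq> d g} \<union> {g \<in> carrier G. d g \<noteq> e g}"]) auto

lemma (in group) shift_closed:
  "g \<in> carrier G \<Longrightarrow> c \<in> carrier G \<rightarrow>\<^sub>E A \<Longrightarrow> shift G g c \<in> carrier G \<rightarrow>\<^sub>E A"
  by (auto simp: shift_def PiE_iff)

lemma (in group) shift_shift_inv: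
  assumes "g \<in> carrier G" "c \<in> carrier G \<rightarrow>\<^sub>E A"
  shows "shift G g (shift G (inv g) c) = c"
proof
  fix x show "shift G g (shift G (inv g) c) x = c x"
    using assms by (cases "x \<in> carrier G") (auto simp: shift_def PiE_iff extensional_def simp flip: m_assoc)
qed

lemma (in group) asymptotic_shift:
  assumes "g \<in> carrier G" "asymptotic G c d"
  shows "asymptotic G (shift G g c) (shift G g d)"
  unfolding asymptotic_def
proof (rule finite_subset)
  show "{x \<in> carrier G. shift G g c x \<noteq> shift G g d x} \<subseteq> (\<lambda>x. g \<otimes> x) ` {x \<in> carrier G. c x \<noteq> d x}"
  proof
    fix x assume x: "x \<in> {x \<in> carrier G. shift G g c x \<noteq> shift G g d x}"
    then have "x = g \<otimes> (inv g \<otimes> x)" using assms(1) by (simp flip: m_assoc)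
    then show "x \<in> (\<lambda>x. g \<otimes> x) ` {x \<in> carrier G. c x \<noteq> d x}"
      using x assms(1) by (intro image_eqI[of _ _ "inv g \<otimes> x"]) (auto simp: shift_def)
  qed
qed (use assms(2) in \<open>simp add: asymptotic_def\<close>)

text \<open>Shifting moves the correction from the identity to any cell, and finitely many
  discrepancies are then removed one after another.\<close>

lemma (in group) post_surjective_if_correctable_at_one:
  assumes ca: "cellular_automaton G A T"
    and one: "\<And>c a. c \<in> carrier G \<rightarrow>\<^sub>E A \<Longrightarrow> a \<in> A \<Longrightarrow>
      \<exists>c'\<in>carrier G \<rightarrow>\<^sub>E A. asymptotic G c' c \<and> T c' = (T c)(\<one> := a)"
  shows "post_surjective G A T"
proof -
  let ?X = "carrier G \<rightarrow>\<^sub>E A"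
  have Tc: "T c \<in> ?X" if "c \<in> ?X" for c
    using ca that by (auto simp: cellular_automaton_def continuous_map_def topspace_full_shift)
  have eqv: "\<And>g c. g \<in> carrier G \<Longrightarrow> c \<in> ?X \<Longrightarrow> T (shift G g c) = shift G g (T c)"
    using ca by (auto simp: cellular_automaton_def topspace_full_shift)
  have site: "\<exists>c'\<in>?X. asymptotic G c' c \<and> T c' = (T c)(g := a)"
    if c: "c \<in> ?X" and a: "a \<in> A" and g: "g \<in> carrier G" for c a g
  proof -
    obtain d where d: "d \<in> ?X" "asymptotic G d (shift G (inv g) c)"
      "T d = (T (shift G (inv g) c))(\<one> := a)"
      using one[OF shift_closed[of "inv g" c A] a] g c by auto
    have "asymptotic G (shift G g d) c"
      using asymptotic_shift[OF g d(2)] shift_shift_inv[OF g c] by simp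
    moreover have "T (shift G g d) = (T c)(g := a)"
    proof
      fix x
      have "inv g \<otimes> x = \<one> \<longleftrightarrow> x = g" if "x \<in> carrier G"
        using that g by (metis inv_equality inv_inv inv_closed l_inv)
      then have "T (shift G g d) x = ((shift G g (shift G (inv g) (T c)))(g := a)) x"
        using g c d eqv[of "inv g" c] eqv[of g d] by (simp add: shift_def)
      then show "T (shift G g d) x = ((T c)(g := a)) x"
        by (simp add: shift_shift_inv[OF g Tc[OF c]])
    qed
    ultimately show ?thesis using shift_closed[OF g d(1)] by blast
  qed
  have "\<exists>c'\<in>?X. asymptotic G c' c \<and> T c' = e"
    if "finite D" "c \<in> ?X" "e \<in> ?X" "{g \<in> carrier G. T c g \<noteq> e g} = D" for D c e
    using that
  proof (induction D arbitrary: c rule: finite_induct)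
    case empty
    then have "T c = e" by (intro PiE_ext[OF Tc]) auto
    then show ?case using empty asymptotic_refl by blast
  next
    case (insert g D)
    then have g: "g \<in> carrier G" by blast
    then obtain b where b: "b \<in> ?X" "asymptotic G b c" "T b = (T c)(g := e g)"
      using site[OF \<open>c \<in> ?X\<close>] insert.prems(2) by blast
    have "{x \<in> carrier G. T b x \<noteq> e x} = D"
      using insert b(3) by auto
    then obtain c' where "c' \<in> ?X" "asymptotic G c' b" "T c' = e"
      using insert.IH[OF b(1)] insert.prems by blast
    then show ?case using asymptotic_trans b(2) by blast
  qed
  then show ?thesis
    unfolding post_surjective_def topspace_full_shift by (auto simp: asymptotic_def)
qed

section \<open>Local embeddings\<close>

text \<open>A copy in \<open>H\<close> of the part of the multiplication table of \<open>G\<close> that is visible in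
  \<open>B\<close>; if this exists for every finite \<open>B\<close>, then \<open>G\<close> is locally embeddable into the
  groups \<open>H\<close> that occur.\<close>

definition local_embedding ::
  "('g, 'm) monoid_scheme \<Rightarrow> ('h, 'n) monoid_scheme \<Rightarrow> 'g set \<Rightarrow> ('g \<Rightarrow> 'h) \<Rightarrow> bool" where
  "local_embedding G H B \<beta> \<longleftrightarrow> \<beta> \<in> B \<rightarrow> carrier H \<and> inj_on \<beta> B \<and>
     (\<forall>x\<in>B. \<forall>y\<in>B. x \<otimes>\<^bsub>G\<^esub> y \<in> B \<longrightarrow> \<beta> (x \<otimes>\<^bsub>G\<^esub> y) = \<beta> x \<otimes>\<^bsub>H\<^esub> \<beta> y)"

text \<open>With memory set \<open>M\<close>, the image at \<open>g\<close> reads the cells \<open>g m\<close>. Hence a change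
  of a configuration on \<open>Q\<close> can be noticed only at the cells in \<open>Q M\<inverse>\<close>. The
  identity is included because it is the cell where the image is to be corrected.\<close>

definition affected :: "('g, 'm) monoid_scheme \<Rightarrow> 'g set \<Rightarrow> 'g set \<Rightarrow> 'g set" where
  "affected G M Q = insert \<one>\<^bsub>G\<^esub> ((\<lambda>(q, m). q \<otimes>\<^bsub>G\<^esub> inv\<^bsub>G\<^esub> m) ` (Q \<times> M))"

text \<open>The cells on which a configuration must be known in order to compute its image on the
  affected cells.\<close>

definition observed :: "('g, 'm) monoid_scheme \<Rightarrow> 'g set \<Rightarrow> 'g set \<Rightarrow> 'g set" where
  "observed G M Q = (\<lambda>(g, m). g \<otimes>\<^bsub>G\<^esub> m) ` (affected G M Q \<times> M)"

definition window :: "('g, 'm) monoid_scheme \<Rightarrow> 'g set \<Rightarrow> 'g set \<Rightarrow> 'g set" where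
  "window G M Q = M \<union> Q \<union> affected G M Q \<union> observed G M Q"

lemma (in group) window:
  assumes "finite M" "M \<subseteq> carrier G" "finite Q" "Q \<subseteq> carrier G"
  shows "finite (window G M Q)" "window G M Q \<subseteq> carrier G"
    "finite (observed G M Q)" "observed G M Q \<subseteq> carrier G"
    "affected G M Q \<subseteq> carrier G"
  using assms unfolding window_def observed_def affected_def
  by (auto 0 3 intro!: m_closed inv_closed)

definition patch :: "('g \<Rightarrow> 'h) \<Rightarrow> 'g set \<Rightarrow> ('g \<Rightarrow> 'a) \<Rightarrow> ('h \<Rightarrow> 'a) \<Rightarrow> ('h \<Rightarrow> 'a)" where
  "patch \<beta> Q c d = (\<lambda>h. if h \<in> \<beta> ` Q then c (inv_into Q \<beta> h) else d h)"

text \<open>Since \<open>\<beta> (g m) = \<beta> g \<beta> m\<close>, the copy of an affected cell reads exactly the copies of the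
  cells that the original reads.\<close>

lemma block_map_local_embedding:
  assumes "local_embedding G H B \<beta>" "window G M Q \<subseteq> B" "B \<subseteq> carrier G"
    and eq: "\<forall>x\<in>observed G M Q. d (\<beta> x) = c x" and g: "g \<in> affected G M Q"
  shows "block_map H M \<beta> \<mu> d (\<beta> g) = block_map G M id \<mu> c g"
proof -
  have gB: "g \<in> B" using g assms(2) by (auto simp: window_def)
  have "d (\<beta> g \<otimes>\<^bsub>H\<^esub> \<beta> m) = c (g \<otimes>\<^bsub>G\<^esub> m)" if m: "m \<in> M" for m
  proof -
    have o: "g \<otimes>\<^bsub>G\<^esub> m \<in> observed G M Q"
      using g m by (force simp: observed_def)
    then have "g \<otimes>\<^bsub>G\<^esub> m \<in> B" "m \<in> B" using assms(2) m by (auto simp: window_def)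
    then have "\<beta> (g \<otimes>\<^bsub>G\<^esub> m) = \<beta> g \<otimes>\<^bsub>H\<^esub> \<beta> m"
      using assms(1) gB by (simp add: local_embedding_def)
    then show ?thesis using bspec[OF eq o] by simp
  qed
  then have "(\<lambda>m\<in>M. d (\<beta> g \<otimes>\<^bsub>H\<^esub> \<beta> m)) = (\<lambda>m\<in>M. c (g \<otimes>\<^bsub>G\<^esub> m))"
    by (intro restrict_ext)
  moreover have "\<beta> g \<in> carrier H" "g \<in> carrier G"
    using assms(1,3) gB by (auto simp: local_embedding_def)
  ultimately show ?thesis by (simp add: block_map_def)
qed

text \<open>The effect of a patch on the image is the same in \<open>H\<close> as in \<open>G\<close>: on copies of
  affected cells the image is the one computed in \<open>G\<close>, and a cell \<open>h\<close> that reads a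
  patched cell \<open>\<beta> q = h \<beta> m\<close> must be such a copy, namely \<open>\<beta> (q m\<inverse>)\<close>, so that elsewhere
  nothing changes.\<close>

lemma block_map_patch:
  assumes "group G" "group H" and emb: "local_embedding G H B \<beta>" and W: "window G M Q \<subseteq> B"
    and B: "B \<subseteq> carrier G"
    and cc': "\<forall>x\<in>carrier G - Q. c' x = c x"
    and eq: "\<forall>x\<in>observed G M Q. d (\<beta> x) = c x"
  shows "g \<in> affected G M Q \<Longrightarrow>
      block_map H M \<beta> \<mu> (patch \<beta> Q c' d) (\<beta> g) = block_map G M id \<mu> c' g"
    and "h \<in> carrier H \<Longrightarrow> h \<notin> \<beta> ` affected G M Q \<Longrightarrow>
      block_map H M \<beta> \<mu> (patch \<beta> Q c' d) h = block_map H M \<beta> \<mu> d h"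
proof -
  interpret G: group G by fact
  interpret H: group H by fact
  have sub: "M \<subseteq> B" "Q \<subseteq> B" "affected G M Q \<subseteq> B" "observed G M Q \<subseteq> B"
    using W by (auto simp: window_def)
  have inj: "inj_on \<beta> B" using emb by (simp add: local_embedding_def)
  have "patch \<beta> Q c' d (\<beta> x) = c' x" if x: "x \<in> observed G M Q" for x
  proof (cases "x \<in> Q")
    case True
    then show ?thesis using inj_on_subset[OF inj sub(2)] by (simp add: patch_def)
  next
    case False
    then have "\<beta> x \<notin> \<beta> ` Q" using inj_on_image_mem_iff[OF inj _ sub(2)] sub(4) x by blast
    then show ?thesis using False x sub B eq cc' by (auto simp: patch_def)
  qed
  then have "\<forall>x\<in>observed G M Q. patch \<beta> Q c' d (\<beta> x) = c' x" by blast
  then show "block_map H M \<beta> \<mu> (patch \<beta> Q c' d) (\<beta> g) = block_map G M id \<mu> c' g"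
    if "g \<in> affected G M Q"
    using block_map_local_embedding[OF emb W B _ that] by blast
  assume h: "h \<in> carrier H" and n: "h \<notin> \<beta> ` affected G M Q"
  have "h \<otimes>\<^bsub>H\<^esub> \<beta> m \<notin> \<beta> ` Q" if m: "m \<in> M" for m
  proof
    assume "h \<otimes>\<^bsub>H\<^esub> \<beta> m \<in> \<beta> ` Q"
    then obtain q where q: "q \<in> Q" "h \<otimes>\<^bsub>H\<^esub> \<beta> m = \<beta> q" by blast
    let ?g = "q \<otimes>\<^bsub>G\<^esub> inv\<^bsub>G\<^esub> m"
    have g: "?g \<in> affected G M Q" using q m by (force simp: affected_def)
    have "?g \<otimes>\<^bsub>G\<^esub> m = q" using q m sub B by (simp add: G.m_assoc subset_iff)
    then have "\<beta> q = \<beta> ?g \<otimes>\<^bsub>H\<^esub> \<beta> m"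
      using emb g m q(1) sub unfolding local_embedding_def by (metis subsetD)
    moreover have "\<beta> ?g \<in> carrier H" "\<beta> m \<in> carrier H"
      using emb g m sub by (auto simp: local_embedding_def)
    ultimately have "h = \<beta> ?g" using q(2) h by simp
    then show False using n g by blast
  qed
  then have "(\<lambda>m\<in>M. patch \<beta> Q c' d (h \<otimes>\<^bsub>H\<^esub> \<beta> m)) = (\<lambda>m\<in>M. d (h \<otimes>\<^bsub>H\<^esub> \<beta> m))"
    by (intro restrict_ext) (simp add: patch_def)
  then show "block_map H M \<beta> \<mu> (patch \<beta> Q c' d) h = block_map H M \<beta> \<mu> d h"
    using h by (simp add: block_map_def)
qed

lemma patch_closed:
  assumes "c \<in> carrier G \<rightarrow>\<^sub>E A" "d \<in> carrier H \<rightarrow>\<^sub>E A" "Q \<subseteq> carrier G" "\<beta> \<in> Q \<rightarrow> carrier H"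
  shows "patch \<beta> Q c d \<in> carrier H \<rightarrow>\<^sub>E A"
proof (rule PiE_I)
  fix h assume "h \<in> carrier H"
  then show "patch \<beta> Q c d h \<in> A"
    using assms(1-3) inv_into_into[of h \<beta> Q] by (auto simp: patch_def)
next
  fix h assume "h \<notin> carrier H"
  then show "patch \<beta> Q c d h = undefined"
    using assms(2,4) by (auto simp: patch_def PiE_iff extensional_def)
qed

lemma asymptotic_patch: "finite Q \<Longrightarrow> asymptotic H (patch \<beta> Q c d) d"
  unfolding asymptotic_def by (rule finite_subset[of _ "\<beta> ` Q"]) (auto simp: patch_def)

lemma local_embedding_one:
  assumes "group G" "group H" "local_embedding G H B \<beta>" "\<one>\<^bsub>G\<^esub> \<in> B"
  shows "\<beta> \<one>\<^bsub>G\<^esub> = \<one>\<^bsub>H\<^esub>"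
proof -
  interpret G: group G by fact
  interpret H: group H by fact
  have "\<beta> \<one>\<^bsub>G\<^esub> \<otimes>\<^bsub>H\<^esub> \<beta> \<one>\<^bsub>G\<^esub> = \<beta> \<one>\<^bsub>G\<^esub>" "\<beta> \<one>\<^bsub>G\<^esub> \<in> carrier H"
    using assms(3,4) by (auto simp: local_embedding_def) (metis G.l_one G.one_closed)
  then show ?thesis by simp
qed

text \<open>\<open>B\<close> is chosen large enough for the pair that violates pre-injectivity and for all of the
  finitely many correction recipes obtained from compactness. Given a configuration on \<open>H\<close>, its
  pull-back to \<open>G\<close> selects a recipe, which is then applied in \<open>H\<close>. Equivalently, a group
  that is locally embeddable into dual surjunctive groups is dual surjunctive.\<close>

theorem not_dual_surjunctive_local:
  fixes G :: "('g, 'm) monoid_scheme"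
  assumes "group G" and nds: "\<not> dual_surjunctive G"
  obtains B where "finite B" "B \<subseteq> carrier G"
    "\<forall>(H :: ('h, 'n) monoid_scheme) \<beta>. group H \<longrightarrow> local_embedding G H B \<beta> \<longrightarrow> \<not> dual_surjunctive H"
proof -
  interpret G: group G by fact
  obtain A :: "nat set" and T where A: "finite A" and ca: "cellular_automaton G A T"
    and post: "post_surjective G A T" and npre: "\<not> pre_injective G A T"
    using nds by (auto simp: dual_surjunctive_def)
  let ?X = "carrier G \<rightarrow>\<^sub>E A"
  obtain p q where pq: "p \<in> ?X" "q \<in> ?X" "asymptotic G p q" "T p = T q" "p \<noteq> q"
    using npre by (auto simp: pre_injective_def topspace_full_shift)
  obtain a\<^sub>0 where a\<^sub>0: "a\<^sub>0 \<in> A" using PiE_mem[OF pq(1) G.one_closed] ..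
  obtain M \<mu> where M: "finite M" "M \<subseteq> carrier G" and \<mu>: "\<mu> \<in> (M \<rightarrow>\<^sub>E A) \<rightarrow> A"
    and T: "\<forall>c\<in>?X. T c = block_map G M id \<mu> c"
    by (rule G.curtis_hedlund_lyndon[OF A _ ca]) (use a\<^sub>0 in auto)
  have Tc: "T c \<in> ?X" if "c \<in> ?X" for c
    using ca that by (auto simp: cellular_automaton_def continuous_map_def topspace_full_shift)
  have "\<exists>c'. c' \<in> ?X \<and> asymptotic G c' c \<and> T c' = (T c)(\<one>\<^bsub>G\<^esub> := a)"
    if c: "c \<in> ?X" and a: "a \<in> A" for c a
  proof -
    have "(T c)(\<one>\<^bsub>G\<^esub> := a) \<in> ?X" using Tc[OF c] a by (auto simp: PiE_iff extensional_def)
    moreover have "asymptotic G (T c) ((T c)(\<one>\<^bsub>G\<^esub> := a))"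
      unfolding asymptotic_def by (rule finite_subset[of _ "{\<one>\<^bsub>G\<^esub>}"]) auto
    ultimately show ?thesis
      using post c unfolding post_surjective_def topspace_full_shift by blast
  qed
  then obtain w where w: "\<And>c a. c \<in> ?X \<Longrightarrow> a \<in> A \<Longrightarrow>
      w c a \<in> ?X \<and> asymptotic G (w c a) c \<and> T (w c a) = (T c)(\<one>\<^bsub>G\<^esub> := a)"
    by metis
  \<comment> \<open>\<open>w c a\<close> is the recipe for \<open>c\<close>: it makes the image equal to \<open>a\<close> at the identity.
    As \<open>A\<close> is finite, one finite support \<open>Q c\<close> serves all \<open>a\<close>.\<close>
  define Q where "Q c = (\<Union>a\<in>A. {x \<in> carrier G. w c a x \<noteq> c x})" for c
  have Q: "finite (Q c)" "Q c \<subseteq> carrier G" if "c \<in> ?X" for c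
    using w[OF that] A by (auto simp: Q_def asymptotic_def)
  obtain F where F: "finite F" "F \<subseteq> ?X"
    "\<forall>d\<in>?X. \<exists>c\<in>F. \<forall>k\<in>observed G M (Q c). d k = c k"
    by (rule finite_cylinder_cover[OF A, of G "\<lambda>c. observed G M (Q c)"]) (use G.window(3,4)[OF M Q] in simp)
  define E where "E = {x \<in> carrier G. p x \<noteq> q x}"
  have E: "finite E" "E \<subseteq> carrier G" using pq(3) by (auto simp: E_def asymptotic_def)
  define B where "B = window G M E \<union> (\<Union>c\<in>F. window G M (Q c))"
  have WQ: "finite (window G M (Q c))" "window G M (Q c) \<subseteq> carrier G" if "c \<in> F" for c
    using G.window(1,2)[OF M Q] F(2) that by auto
  then have B: "finite B" "B \<subseteq> carrier G"
    unfolding B_def using F(1) G.window(1,2)[OF M E] by auto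
  show thesis
  proof (rule that[OF B], intro allI impI)
    fix H :: "('h, 'n) monoid_scheme" and \<beta>
    assume "group H" and emb: "local_embedding G H B \<beta>"
    interpret H: group H by fact
    let ?Y = "carrier H \<rightarrow>\<^sub>E A" and ?U = "block_map H M \<beta> \<mu>"
    have \<beta>: "\<beta> \<in> B \<rightarrow> carrier H" and inj: "inj_on \<beta> B" using emb by (auto simp: local_embedding_def)
    have MB: "M \<subseteq> B" and EB: "E \<subseteq> B" and WE: "window G M E \<subseteq> B" and OE: "observed G M E \<subseteq> B"
      and oneB: "\<one>\<^bsub>G\<^esub> \<in> B"
      by (auto simp: B_def window_def affected_def)
    have \<beta>_one: "\<beta> \<one>\<^bsub>G\<^esub> = \<one>\<^bsub>H\<^esub>"
      using local_embedding_one[OF \<open>group G\<close> \<open>group H\<close> emb oneB] .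
    have \<beta>M: "\<beta> \<in> M \<rightarrow> carrier H" using \<beta> MB by auto
    have caU: "cellular_automaton H A ?U"
      by (rule H.cellular_automaton_block_map[OF M(1) \<beta>M \<mu>])
    have UY: "?U d \<in> ?Y" if "d \<in> ?Y" for d
      by (rule H.block_map_closed[OF \<beta>M \<mu> that])
    have "post_surjective H A ?U"
    proof (rule H.post_surjective_if_correctable_at_one[OF caU])
      fix d a assume d: "d \<in> ?Y" and a: "a \<in> A"
      \<comment> \<open>the pull-back of \<open>d\<close> along \<open>\<beta>\<close>, filled up outside \<open>B\<close>\<close>
      define dG where "dG = (\<lambda>x\<in>carrier G. if x \<in> B then d (\<beta> x) else a\<^sub>0)"
      have "dG \<in> ?X" using d \<beta> a\<^sub>0 by (auto simp: dG_def PiE_iff)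
      then obtain c where c: "c \<in> F" "\<forall>k\<in>observed G M (Q c). dG k = c k" using F(3) by blast
      then have cX: "c \<in> ?X" using F(2) by blast
      have W: "window G M (Q c) \<subseteq> B" using c(1) by (auto simp: B_def)
      then have QB: "Q c \<subseteq> B" "observed G M (Q c) \<subseteq> B" by (auto simp: window_def)
      have eq: "\<forall>x\<in>observed G M (Q c). d (\<beta> x) = c x"
      proof
        fix x assume x: "x \<in> observed G M (Q c)"
        then have "x \<in> B" "x \<in> carrier G" using QB(2) B(2) by blast+
        then show "d (\<beta> x) = c x" using bspec[OF c(2) x] by (simp add: dG_def)
      qed
      let ?c' = "w c a" and ?d' = "patch \<beta> (Q c) (w c a) d"
      have off: "\<forall>x\<in>carrier G - Q c. ?c' x = c x"
        using a by (simp add: Q_def)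
      have c': "?c' \<in> ?X" "block_map G M id \<mu> ?c' = (block_map G M id \<mu> c)(\<one>\<^bsub>G\<^esub> := a)"
        using w[OF cX a] bspec[OF T cX] bspec[OF T, of ?c'] by simp_all
      have d': "?d' \<in> ?Y"
        using \<beta> QB(1) by (intro patch_closed[OF c'(1) d Q(2)[OF cX]]) auto
      have "?U ?d' h = ((?U d)(\<one>\<^bsub>H\<^esub> := a)) h" if h: "h \<in> carrier H" for h
      proof (cases "h \<in> \<beta> ` affected G M (Q c)")
        case True
        then obtain g where g: "g \<in> affected G M (Q c)" "h = \<beta> g" by blast
        have "g \<in> B" using g(1) W by (auto simp: window_def)
        then have "h = \<one>\<^bsub>H\<^esub> \<longleftrightarrow> g = \<one>\<^bsub>G\<^esub>" using g(2) \<beta>_one inj oneB by (metis inj_onD)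
        moreover have "?U ?d' h = block_map G M id \<mu> ?c' g"
          unfolding g(2) by (rule block_map_patch(1)[OF \<open>group G\<close> \<open>group H\<close> emb W B(2) off eq g(1)])
        moreover have "?U d h = block_map G M id \<mu> c g"
          using block_map_local_embedding[OF emb W B(2) eq g(1)] g(2) by simp
        ultimately show ?thesis using c'(2) by simp
      next
        case False
        then have "h \<noteq> \<one>\<^bsub>H\<^esub>" using \<beta>_one by (auto simp: affected_def)
        moreover have "?U ?d' h = ?U d h"
          by (rule block_map_patch(2)[OF \<open>group G\<close> \<open>group H\<close> emb W B(2) off eq h False])
        ultimately show ?thesis by simp
      qed
      moreover have "?U ?d' h = ((?U d)(\<one>\<^bsub>H\<^esub> := a)) h" if "h \<notin> carrier H" for h
        using that by (auto simp: block_map_def)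
      ultimately have "?U ?d' = (?U d)(\<one>\<^bsub>H\<^esub> := a)" by blast
      then show "\<exists>d'\<in>?Y. asymptotic H d' d \<and> ?U d' = (?U d)(\<one>\<^bsub>H\<^esub> := a)"
        using d' asymptotic_patch[OF Q(1)[OF cX]] by blast
    qed
    moreover have "\<not> pre_injective H A ?U"
    proof -
      \<comment> \<open>\<open>P\<close> is a push-forward of \<open>p\<close>; patching it with \<open>q\<close> on \<open>E\<close> gives the
        second member of the pair\<close>
      define P where "P = patch \<beta> B p (\<lambda>h\<in>carrier H. a\<^sub>0)"
      have P: "P \<in> ?Y"
        unfolding P_def using a\<^sub>0 by (intro patch_closed[OF pq(1) _ B(2) \<beta>]) auto
      have P\<beta>: "P (\<beta> x) = p x" if "x \<in> B" for x
        using that inj by (simp add: P_def patch_def)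
      let ?R = "patch \<beta> E q P"
      have R: "?R \<in> ?Y" using \<beta> EB by (intro patch_closed[OF pq(2) P E(2)]) auto
      have off: "\<forall>x\<in>carrier G - E. q x = p x" by (auto simp: E_def)
      have eq: "\<forall>x\<in>observed G M E. P (\<beta> x) = p x" using OE P\<beta> by blast
      have "?U ?R h = ?U P h" if h: "h \<in> carrier H" for h
      proof (cases "h \<in> \<beta> ` affected G M E")
        case True
        then obtain g where g: "g \<in> affected G M E" "h = \<beta> g" by blast
        have "?U ?R h = block_map G M id \<mu> q g"
          unfolding g(2) by (rule block_map_patch(1)[OF \<open>group G\<close> \<open>group H\<close> emb WE B(2) off eq g(1)])
        moreover have "?U P h = block_map G M id \<mu> p g"
          using block_map_local_embedding[OF emb WE B(2) eq g(1)] g(2) by simp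
        ultimately show ?thesis using pq(4) bspec[OF T pq(1)] bspec[OF T pq(2)] by simp
      next
        case False
        show ?thesis
          by (rule block_map_patch(2)[OF \<open>group G\<close> \<open>group H\<close> emb WE B(2) off eq h False])
      qed
      then have "?U ?R = ?U P" by (intro PiE_ext[OF UY[OF R] UY[OF P]])
      moreover obtain e where e: "e \<in> E" using PiE_ext[OF pq(1,2)] pq(5) by (auto simp: E_def)
      have "?R (\<beta> e) = q e" using e inj_on_subset[OF inj EB] by (simp add: patch_def)
      then have "?R \<noteq> P" using P\<beta> e EB by (auto simp: E_def)
      ultimately show ?thesis
        using P R asymptotic_patch[OF E(1)] unfolding pre_injective_def topspace_full_shift by blast
    qed
    ultimately show "\<not> dual_surjunctive H" using A caU by (auto simp: dual_surjunctive_def)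
  qed
qed

section \<open>Neighbourhoods in the space of marked groups\<close>

lemma openin_agree_on_finite:
  assumes "finite K" "K \<subseteq> carrier (free_group S)"
  shows "openin (marked_groups S) {N'. N' \<lhd> free_group S \<and> N' \<inter> K = N \<inter> K}"
proof -
  let ?X = "carrier (free_group S)"
  let ?U = "\<lambda>x. if x \<in> K then {x \<in> N} else UNIV"
  have "finite {x \<in> ?X. ?U x \<noteq> UNIV}"
    by (rule finite_subset[OF _ assms(1)]) auto
  then have "openin (product_topology (\<lambda>_. discrete_topology (UNIV :: bool set)) ?X) (PiE ?X ?U)"
    unfolding openin_PiE_gen by simp
  moreover have "N' \<subseteq> ?X \<and> N' \<inter> K = N \<inter> K \<longleftrightarrow>
      N' \<in> (\<lambda>N. \<lambda>x\<in>?X. x \<in> N) -` PiE ?X ?U \<inter> Pow ?X" for N'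
  proof -
    have "(\<lambda>x\<in>?X. x \<in> N') \<in> PiE ?X ?U \<longleftrightarrow> (\<forall>x\<in>K. x \<in> N' \<longleftrightarrow> x \<in> N)"
      using assms(2) unfolding restrict_PiE_iff by auto
    then show ?thesis by blast
  qed
  then have "{N'. N' \<subseteq> ?X \<and> N' \<inter> K = N \<inter> K} = (\<lambda>N. \<lambda>x\<in>?X. x \<in> N) -` PiE ?X ?U \<inter> Pow ?X"
    by blast
  ultimately have "openin (powerset_topology ?X) {N'. N' \<subseteq> ?X \<and> N' \<inter> K = N \<inter> K}"
    unfolding powerset_topology_def openin_pullback_topology by blast
  moreover have "{N'. N' \<lhd> free_group S \<and> N' \<inter> K = N \<inter> K} =
      {N'. N' \<subseteq> ?X \<and> N' \<inter> K = N \<inter> K} \<inter> {N. N \<lhd> free_group S}"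
    by (auto dest: normal_imp_subgroup subgroup.subset)
  ultimately show ?thesis
    unfolding marked_groups_def openin_subtopology by blast
qed

text \<open>For coset representatives \<open>r x\<close> of the elements \<open>x \<in> B\<close>, equality of two elements
  of \<open>B\<close> and validity of a product \<open>x y = z\<close> in \<open>B\<close> say that \<open>r x (r y)\<inverse>\<close>
  or \<open>r x r y (r z)\<inverse>\<close> lies in the kernel. If \<open>N'\<close> answers these finitely many membership
  questions as \<open>N\<close> does, then sending \<open>x\<close> to the coset of \<open>r x\<close> modulo
  \<open>N'\<close> is a local embedding.\<close>

lemma (in group) quotient_local_embedding:
  assumes N: "N \<lhd> G" and B: "finite B" "B \<subseteq> carrier (G Mod N)"
  obtains K where "finite K" "K \<subseteq> carrier G"
    "\<forall>N'. N' \<lhd> G \<longrightarrow> N' \<inter> K = N \<inter> K \<longrightarrow> (\<exists>\<beta>. local_embedding (G Mod N) (G Mod N') B \<beta>)"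
proof -
  interpret N: normal N G by fact
  have "\<exists>g\<in>carrier G. x = N #> g" if "x \<in> B" for x
    using that B(2) by (auto simp: FactGroup_def RCOSETS_def)
  then obtain r where r: "\<And>x. x \<in> B \<Longrightarrow> r x \<in> carrier G" "\<And>x. x \<in> B \<Longrightarrow> x = N #> r x"
    by metis
  define K where "K = (\<lambda>(x, y). r x \<otimes> inv (r y)) ` (B \<times> B) \<union>
     (\<lambda>(x, y, z). r x \<otimes> r y \<otimes> inv (r z)) ` (B \<times> B \<times> B)"
  have coset_eq: "L #> a = L #> b \<longleftrightarrow> a \<otimes> inv b \<in> L"
    if "subgroup L G" "a \<in> carrier G" "b \<in> carrier G" for L a b
    using that by (metis coset_join1 coset_join2 coset_mult_assoc coset_mult_inv1 coset_mult_inv2 inv_closed m_closed subgroup.subset)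
  show thesis
  proof (rule that[of K])
    show "finite K" using B(1) by (simp add: K_def)
    show "K \<subseteq> carrier G" using r(1) by (auto simp: K_def)
    show "\<forall>N'. N' \<lhd> G \<longrightarrow> N' \<inter> K = N \<inter> K \<longrightarrow> (\<exists>\<beta>. local_embedding (G Mod N) (G Mod N') B \<beta>)"
    proof (intro allI impI)
      fix N' assume N': "N' \<lhd> G" and agree: "N' \<inter> K = N \<inter> K"
      interpret N': normal N' G by fact
      let ?\<beta> = "\<lambda>x. N' #> r x"
      have "?\<beta> x \<in> carrier (G Mod N')" if "x \<in> B" for x
        using r(1)[OF that] by (auto simp: FactGroup_def RCOSETS_def)
      moreover have "inj_on ?\<beta> B"
      proof (rule inj_onI)
        fix x y assume xy: "x \<in> B" "y \<in> B" "N' #> r x = N' #> r y"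
        then have "r x \<otimes> inv (r y) \<in> N'" using coset_eq[OF N'.subgroup_axioms] r(1) by blast
        moreover have "r x \<otimes> inv (r y) \<in> K" using xy by (force simp: K_def)
        ultimately have "r x \<otimes> inv (r y) \<in> N" using agree by blast
        then have "N #> r x = N #> r y" using coset_eq[OF N.subgroup_axioms] r(1) xy by blast
        then show "x = y" using r(2) xy by metis
      qed
      moreover have "?\<beta> (x \<otimes>\<^bsub>G Mod N\<^esub> y) = ?\<beta> x \<otimes>\<^bsub>G Mod N'\<^esub> ?\<beta> y"
        if x: "x \<in> B" and y: "y \<in> B" and z: "x \<otimes>\<^bsub>G Mod N\<^esub> y \<in> B" for x y
      proof -
        let ?z = "x \<otimes>\<^bsub>G Mod N\<^esub> y"
        have "N #> r ?z = ?z" using r(2)[OF z] by simp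
        also have "\<dots> = (N #> r x) <#> (N #> r y)" using r(2)[OF x] r(2)[OF y] by (simp add: FactGroup_def)
        also have "\<dots> = N #> (r x \<otimes> r y)" using N.rcos_sum r(1) x y by blast
        finally have "r x \<otimes> r y \<otimes> inv (r ?z) \<in> N"
          using coset_eq[OF N.subgroup_axioms] r(1) x y z by (metis m_closed)
        moreover have "r x \<otimes> r y \<otimes> inv (r ?z) \<in> K"
          unfolding K_def using x y z by (intro UnI2 image_eqI[of _ _ "(x, y, ?z)"]) auto
        ultimately have "r x \<otimes> r y \<otimes> inv (r ?z) \<in> N'" using agree by blast
        then have "N' #> (r x \<otimes> r y) = N' #> r ?z"
          using coset_eq[OF N'.subgroup_axioms] r(1) x y z by blast
        then show ?thesis using N'.rcos_sum r(1) x y by (simp add: FactGroup_def)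
      qed
      ultimately show "\<exists>\<beta>. local_embedding (G Mod N) (G Mod N') B \<beta>"
        unfolding local_embedding_def by (intro exI[of _ ?\<beta>]) blast
    qed
  qed
qed

theorem theorem3p6:
  fixes S :: "'s set"
  assumes "finite S"
  shows "closedin (marked_groups S) {N. N \<lhd> free_group S \<and> dual_surjunctive (free_group S Mod N)}"
proof -
  interpret F: group "free_group S" by (rule group_free_group)
  let ?D = "{N. N \<lhd> free_group S \<and> dual_surjunctive (free_group S Mod N)}"
  have "\<exists>V. openin (marked_groups S) V \<and> N \<in> V \<and> V \<subseteq> topspace (marked_groups S) - ?D"
    if "N \<in> topspace (marked_groups S) - ?D" for N
  proof -
    have N: "N \<lhd> free_group S" and nds: "\<not> dual_surjunctive (free_group S Mod N)"
      using that by (auto simp: topspace_marked_groups)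
    obtain B where B: "finite B" "B \<subseteq> carrier (free_group S Mod N)"
      "\<forall>(H :: ('s \<times> bool) list set monoid) \<beta>. group H \<longrightarrow>
         local_embedding (free_group S Mod N) H B \<beta> \<longrightarrow> \<not> dual_surjunctive H"
      by (rule not_dual_surjunctive_local[OF normal.factorgroup_is_group[OF N] nds])
    obtain K where K: "finite K" "K \<subseteq> carrier (free_group S)"
      "\<forall>N'. N' \<lhd> free_group S \<longrightarrow> N' \<inter> K = N \<inter> K \<longrightarrow>
         (\<exists>\<beta>. local_embedding (free_group S Mod N) (free_group S Mod N') B \<beta>)"
      by (rule F.quotient_local_embedding[OF N B(1,2)])
    let ?V = "{N'. N' \<lhd> free_group S \<and> N' \<inter> K = N \<inter> K}"
    have "\<not> dual_surjunctive (free_group S Mod N')" if "N' \<in> ?V" for N'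
      using that K(3) B(3) normal.factorgroup_is_group by blast
    then show ?thesis
      using openin_agree_on_finite[OF K(1,2), of N] N
      by (intro exI[of _ ?V]) (auto simp: topspace_marked_groups)
  qed
  then have "openin (marked_groups S) (topspace (marked_groups S) - ?D)"
    using openin_subopen by (metis (no_types, lifting))
  then show ?thesis
    by (auto simp: closedin_def topspace_marked_groups)
qed

end
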